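(* Let $F_3$ be the free group on $x_1,x_2,x_3$, let $Y=\{x_1,x_2\}$, let $R$ be the normal closure of $Y$ in $F_3$, and let $M=F_3/[R,R]$. Then every matrix in $GL_2(\mathbf{Z}[t^{\pm1}])$ is tame if and only if every 2-element set $\widetilde Y$ of elements of $M$ whose normal closure in $M$ equals the normal closure of $Y$ in $M$ (that is, the image of $R$) is AC-equivalent to $Y$ in the group $M$.
   Context: $\mathbf{Z}[t^{\pm1}]$ is the ring of Laurent polynomials in one variable with integer coefficients. An invertible square matrix over a ring is tame if it is a product of elementary matrices (identity matrix plus a single off-diagonal entry) and invertible diagonal matrices. Elements of $F_3$ and their images in $M$ are denoted by the same letters. AC-equivalence in a group $G$: for a tuple $(y_1,\dots,y_m)$ of elements of $G$, consider (AC1) replace $y_i$ by $y_iy_j$ for some $j\neq i$; (AC2) replace $y_i$ by $y_i^{-1}$; (AC3) replace $y_i$ by $gy_ig^{-1}$ for some $g\in G$ (all other entries unchanged). Two tuples (or finite sets, listed as tuples) are AC-equivalent in $G$ if one is obtained from the other by a finite sequence of such transformations. *)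

theory Defs
  imports "HOL-Analysis.Analysis" "HOL-Algebra.Generated_Groups" "HOL-Library.Poly_Mapping"
begin

section \<open>Free groups\<close>

text \<open>The free group on a set \<open>S\<close> is realised by the reduced words over \<open>S\<close> and its formal
  inverses. The letter \<open>(x, True)\<close> stands for \<open>x\<close> and \<open>(x, False)\<close> for the inverse of \<open>x\<close>.\<close>

definition inv_letter :: "'a \<times> bool \<Rightarrow> 'a \<times> bool" where
  "inv_letter p = (fst p, \<not> snd p)"

fun reduced_word :: "('a \<times> bool) list \<Rightarrow> bool" where
  "reduced_word (p # q # w) \<longleftrightarrow> q \<noteq> inv_letter p \<and> reduced_word (q # w)"
| "reduced_word _ \<longleftrightarrow> True"

text \<open>Left multiplication of a reduced word by a letter.\<close>

fun cons_letter :: "'a \<times> bool \<Rightarrow> ('a \<times> bool) list \<Rightarrow> ('a \<times> bool) list" where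
  "cons_letter p [] = [p]"
| "cons_letter p (q # w) = (if q = inv_letter p then w else p # q # w)"

definition free_group :: "'a set \<Rightarrow> ('a \<times> bool) list monoid" where
  "free_group S = \<lparr>carrier = {w. reduced_word w \<and> fst ` set w \<subseteq> S}, mult = foldr cons_letter, one = []\<rparr>"

definition free_gen :: "'a \<Rightarrow> ('a \<times> bool) list" where
  "free_gen x = [(x, True)]"

lemma inv_letter_inv_letter [simp]: "inv_letter (inv_letter p) = p"
  by (simp add: inv_letter_def)

lemma fst_inv_letter [simp]: "fst (inv_letter p) = fst p"
  by (simp add: inv_letter_def)

lemma reduced_tl: "reduced_word (p # w) \<Longrightarrow> reduced_word w"
  by (cases w) auto

lemma reduced_cons_letter: "reduced_word w \<Longrightarrow> reduced_word (cons_letter p w)"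
  by (cases w) (auto dest: reduced_tl)

lemma cons_letter_cancel: "reduced_word w \<Longrightarrow> cons_letter p (cons_letter (inv_letter p) w) = w"
  by (cases w; cases "tl w") auto

lemma reduced_foldr: "reduced_word w \<Longrightarrow> reduced_word (foldr cons_letter u w)"
  by (induction u) (auto intro: reduced_cons_letter)

lemma set_cons_letter: "set (cons_letter p w) \<subseteq> insert p (set w)"
  by (cases w) auto

lemma set_foldr: "set (foldr cons_letter u w) \<subseteq> set u \<union> set w"
proof (induction u)
  case (Cons p u)
  then show ?case
    using set_cons_letter[of p "foldr cons_letter u w"] by auto
qed auto

lemma foldr_cons_letter:
  assumes "reduced_word w"
  shows "foldr cons_letter (cons_letter p v) w = cons_letter p (foldr cons_letter v w)"
proof (cases v)
  case (Cons q v')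
  then show ?thesis
    using cons_letter_cancel[OF reduced_foldr[OF assms], of p v'] by auto
qed simp

lemma foldr_assoc:
  "reduced_word w \<Longrightarrow> foldr cons_letter (foldr cons_letter u v) w = foldr cons_letter u (foldr cons_letter v w)"
  by (induction u) (auto simp: foldr_cons_letter)

lemma foldr_Nil: "reduced_word u \<Longrightarrow> foldr cons_letter u [] = u"
proof (induction u)
  case (Cons p u)
  then show ?case
    using reduced_tl[OF Cons.prems] by (cases u) auto
qed simp

lemma foldr_inverse:
  "reduced_word w \<Longrightarrow> foldr cons_letter (rev (map inv_letter u)) (foldr cons_letter u w) = w"
proof (induction u)
  case (Cons p u)
  then show ?case
    using cons_letter_cancel[OF reduced_foldr[OF Cons.prems], of "inv_letter p" u] by simp
qed simp

lemma group_free_group: "group (free_group S)"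
proof (rule groupI)
  fix u assume u: "u \<in> carrier (free_group S)"
  let ?v = "foldr cons_letter (rev (map inv_letter u)) []"
  have "fst ` set ?v \<subseteq> fst ` set (rev (map inv_letter u))"
    using set_foldr[of "rev (map inv_letter u)" "[]"] by auto
  also have "\<dots> = fst ` set u"
    by (simp add: image_image)
  finally have "?v \<in> carrier (free_group S)"
    using u by (auto simp: free_group_def intro: reduced_foldr)
  moreover have "?v \<otimes>\<^bsub>free_group S\<^esub> u = \<one>\<^bsub>free_group S\<^esub>"
    using u foldr_inverse[of "[]" u] by (simp add: free_group_def foldr_assoc foldr_Nil)
  ultimately show "\<exists>v\<in>carrier (free_group S). v \<otimes>\<^bsub>free_group S\<^esub> u = \<one>\<^bsub>free_group S\<^esub>"
    by blast
next
  fix u v assume "u \<in> carrier (free_group S)" "v \<in> carrier (free_group S)"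
  then show "u \<otimes>\<^bsub>free_group S\<^esub> v \<in> carrier (free_group S)"
    using set_foldr[of u v] by (fastforce simp: free_group_def intro: reduced_foldr)
qed (auto simp: free_group_def foldr_assoc)

lemma free_gen_in_carrier: "x \<in> S \<Longrightarrow> free_gen x \<in> carrier (free_group S)"
  by (simp add: free_group_def free_gen_def)

text \<open>The universal property of the free group.\<close>

lemma free_group_hom_exists:
  assumes "group H" "f \<in> S \<rightarrow> carrier H"
  shows "\<exists>h\<in>hom (free_group S) H. \<forall>x\<in>S. h (free_gen x) = f x"
proof -
  interpret H: group H by fact
  define g where "g p = (if snd p then f (fst p) else inv\<^bsub>H\<^esub> f (fst p))" for p
  define h where "h w = foldr (\<lambda>p a. g p \<otimes>\<^bsub>H\<^esub> a) w \<one>\<^bsub>H\<^esub>" for w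
  have g: "g p \<in> carrier H" if "fst p \<in> S" for p
    using assms(2) that by (auto simp: g_def)
  have g_inv: "g (inv_letter p) = inv\<^bsub>H\<^esub> (g p)" if "fst p \<in> S" for p
    using funcset_mem[OF assms(2) that] by (simp add: g_def inv_letter_def)
  have h: "h w \<in> carrier H" if "fst ` set w \<subseteq> S" for w
    using that by (induction w) (auto simp: h_def g)
  have h_cons: "h (cons_letter p w) = g p \<otimes>\<^bsub>H\<^esub> h w" if "fst p \<in> S" "fst ` set w \<subseteq> S" for p w
  proof (cases w)
    case (Cons q v)
    have "h v = g p \<otimes>\<^bsub>H\<^esub> (inv\<^bsub>H\<^esub> (g p) \<otimes>\<^bsub>H\<^esub> h v)"
      using h[of v] g[OF that(1)] that(2) Cons by (simp add: H.m_assoc[symmetric])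
    then show ?thesis
      using Cons that g_inv[OF that(1)] by (auto simp: h_def)
  qed (simp add: h_def)
  have h_mult: "h (foldr cons_letter u v) = h u \<otimes>\<^bsub>H\<^esub> h v"
    if "fst ` set u \<subseteq> S" "fst ` set v \<subseteq> S" for u v
    using that(1)
  proof (induction u)
    case Nil
    then show ?case using h[OF that(2)] by (simp add: h_def)
  next
    case (Cons p u)
    have "fst ` set (foldr cons_letter u v) \<subseteq> S"
      using set_foldr[of u v] Cons.prems that(2) by fastforce
    then have "h (foldr cons_letter (p # u) v) = g p \<otimes>\<^bsub>H\<^esub> (h u \<otimes>\<^bsub>H\<^esub> h v)"
      using Cons by (simp add: h_cons)
    also have "\<dots> = h (p # u) \<otimes>\<^bsub>H\<^esub> h v"
      using Cons.prems g[of p] h[of u] h[OF that(2)] by (simp add: h_def H.m_assoc)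
    finally show ?case .
  qed
  have "h \<in> hom (free_group S) H"
    by (rule homI) (auto simp: free_group_def h h_mult)
  moreover have "h (free_gen x) = f x" if "x \<in> S" for x
    using funcset_mem[OF assms(2) that] by (simp add: h_def g_def free_gen_def)
  ultimately show ?thesis by blast
qed

lemma free_group_generate: "generate (free_group S) (free_gen ` S) = carrier (free_group S)"
proof
  interpret F: group "free_group S" by (rule group_free_group)
  show "generate (free_group S) (free_gen ` S) \<subseteq> carrier (free_group S)"
    by (rule F.generate_incl) (auto intro: free_gen_in_carrier)
  have letter: "[p] \<in> generate (free_group S) (free_gen ` S)" if "fst p \<in> S" for p
  proof (cases "snd p")
    case True
    then have "[p] = free_gen (fst p)"
      by (simp add: free_gen_def prod_eq_iff)
    then show ?thesis
      using that by (auto intro: generate.incl)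
  next
    case False
    have "inv\<^bsub>free_group S\<^esub> (free_gen (fst p)) = [p]"
      by (rule F.inv_equality)
        (use False that in \<open>auto simp: free_group_def free_gen_def inv_letter_def prod_eq_iff\<close>)
    then show ?thesis
      using that by (metis generate.inv image_eqI)
  qed
  show "carrier (free_group S) \<subseteq> generate (free_group S) (free_gen ` S)"
  proof
    fix w assume "w \<in> carrier (free_group S)"
    then have "reduced_word w" "fst ` set w \<subseteq> S"
      by (auto simp: free_group_def)
    then show "w \<in> generate (free_group S) (free_gen ` S)"
    proof (induction w)
      case Nil
      then show ?case
        using generate.one[of "free_group S"] by (simp add: free_group_def)
    next
      case (Cons p w)
      have "[p] \<otimes>\<^bsub>free_group S\<^esub> w = p # w"
        using Cons.prems foldr_Nil[of "p # w"] foldr_Nil[OF reduced_tl[OF Cons.prems(1)]]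
        by (simp add: free_group_def)
      moreover have "w \<in> generate (free_group S) (free_gen ` S)"
        using Cons.IH Cons.prems reduced_tl[OF Cons.prems(1)] by simp
      ultimately show ?case
        using generate.eng[OF letter] Cons.prems by fastforce
    qed
  qed
qed


section \<open>Normal closures and AC-equivalence\<close>

definition normal_closure :: "('a, 'b) monoid_scheme \<Rightarrow> 'a set \<Rightarrow> 'a set" where
  "normal_closure G S = \<Inter>{N. N \<lhd> G \<and> S \<subseteq> N}"

text \<open>A tuple is a list; its entries are indexed from 0.\<close>

inductive ac_step :: "('a, 'b) monoid_scheme \<Rightarrow> 'a list \<Rightarrow> 'a list \<Rightarrow> bool" for G where
  AC1: "\<lbrakk>i < length ys; j < length ys; i \<noteq> j\<rbrakk> \<Longrightarrow> ac_step G ys (ys[i := ys ! i \<otimes>\<^bsub>G\<^esub> ys ! j])"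
| AC2: "i < length ys \<Longrightarrow> ac_step G ys (ys[i := inv\<^bsub>G\<^esub> (ys ! i)])"
| AC3: "\<lbrakk>i < length ys; g \<in> carrier G\<rbrakk> \<Longrightarrow>
    ac_step G ys (ys[i := g \<otimes>\<^bsub>G\<^esub> ys ! i \<otimes>\<^bsub>G\<^esub> inv\<^bsub>G\<^esub> g])"

definition ac_equivalent :: "('a, 'b) monoid_scheme \<Rightarrow> 'a list \<Rightarrow> 'a list \<Rightarrow> bool" where
  "ac_equivalent G = (ac_step G)\<^sup>*\<^sup>*"

text \<open>Finite sets are listed as tuples without repetition. The choice of the listings is
  immaterial, since AC-transformations can permute the entries of a tuple; see
  \<open>ac_equivalent_swap\<close> for pairs.\<close>

definition ac_equivalent_sets :: "('a, 'b) monoid_scheme \<Rightarrow> 'a set \<Rightarrow> 'a set \<Rightarrow> bool" where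
  "ac_equivalent_sets G A B \<longleftrightarrow>
    (\<exists>as bs. distinct as \<and> set as = A \<and> distinct bs \<and> set bs = B \<and> ac_equivalent G as bs)"

lemma ac_equivalent_swap:
  assumes "group G" "a \<in> carrier G" "b \<in> carrier G"
  shows "ac_equivalent G [a, b] [b, a]"
proof -
  interpret group G by fact
  note [simp] = assms(2,3) inv_mult_group
  have "ac_step G [a, b] [a \<otimes>\<^bsub>G\<^esub> b, b]"
    using AC1[of 0 "[a, b]" 1 G] by simp
  moreover have "ac_step G [a \<otimes>\<^bsub>G\<^esub> b, b] [inv\<^bsub>G\<^esub> b \<otimes>\<^bsub>G\<^esub> inv\<^bsub>G\<^esub> a, b]"
    using AC2[of 0 "[a \<otimes>\<^bsub>G\<^esub> b, b]" G] by simp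
  moreover have "ac_step G [inv\<^bsub>G\<^esub> b \<otimes>\<^bsub>G\<^esub> inv\<^bsub>G\<^esub> a, b] [inv\<^bsub>G\<^esub> b \<otimes>\<^bsub>G\<^esub> inv\<^bsub>G\<^esub> a, inv\<^bsub>G\<^esub> a]"
    using AC1[of 1 "[inv\<^bsub>G\<^esub> b \<otimes>\<^bsub>G\<^esub> inv\<^bsub>G\<^esub> a, b]" 0 G] by (simp add: m_assoc[symmetric])
  moreover have "ac_step G [inv\<^bsub>G\<^esub> b \<otimes>\<^bsub>G\<^esub> inv\<^bsub>G\<^esub> a, inv\<^bsub>G\<^esub> a] [inv\<^bsub>G\<^esub> b \<otimes>\<^bsub>G\<^esub> inv\<^bsub>G\<^esub> a, a]"
    using AC2[of 1 "[inv\<^bsub>G\<^esub> b \<otimes>\<^bsub>G\<^esub> inv\<^bsub>G\<^esub> a, inv\<^bsub>G\<^esub> a]" G] by simp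
  moreover have "ac_step G [inv\<^bsub>G\<^esub> b \<otimes>\<^bsub>G\<^esub> inv\<^bsub>G\<^esub> a, a] [inv\<^bsub>G\<^esub> b, a]"
    using AC1[of 0 "[inv\<^bsub>G\<^esub> b \<otimes>\<^bsub>G\<^esub> inv\<^bsub>G\<^esub> a, a]" 1 G] by (simp add: m_assoc)
  moreover have "ac_step G [inv\<^bsub>G\<^esub> b, a] [b, a]"
    using AC2[of 0 "[inv\<^bsub>G\<^esub> b, a]" G] by simp
  ultimately show ?thesis
    unfolding ac_equivalent_def by (meson converse_rtranclp_into_rtranclp rtranclp.rtrancl_refl)
qed


section \<open>The groups \<open>F\<^sub>3\<close> and \<open>M = F\<^sub>3 / [R, R]\<close>\<close>

definition F3 :: "(nat \<times> bool) list monoid" where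
  "F3 = free_group {1, 2, 3}"

definition R3 :: "(nat \<times> bool) list set" where
  "R3 = normal_closure F3 {free_gen 1, free_gen 2}"

text \<open>\<open>derived F3 R3\<close> is the commutator subgroup \<open>[R, R]\<close>; the elements of \<open>M3\<close> are its cosets
  in \<open>F3\<close>, and \<open>proj_M3\<close> is the canonical projection.\<close>

definition M3 :: "(nat \<times> bool) list set monoid" where
  "M3 = F3 Mod derived F3 R3"

definition proj_M3 :: "(nat \<times> bool) list \<Rightarrow> (nat \<times> bool) list set" where
  "proj_M3 w = derived F3 R3 #>\<^bsub>F3\<^esub> w"


section \<open>Laurent polynomials and tame matrices\<close>

text \<open>Finitely supported functions from exponents to coefficients; multiplication in
  \<^theory>\<open>HOL-Library.Poly_Mapping\<close> is convolution, so this type is the ring of integral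
  Laurent polynomials, with \<open>t\<close> given by \<open>Poly_Mapping.single 1 1\<close>.\<close>

type_synonym int_laurent = "int \<Rightarrow>\<^sub>0 int"

definition elementary_matrix :: "'a::comm_ring_1^'n^'n \<Rightarrow> bool" where
  "elementary_matrix A \<longleftrightarrow>
    (\<exists>k l c. k \<noteq> l \<and> A = mat 1 + (\<chi> i j. if i = k \<and> j = l then c else 0))"

definition diagonal_matrix :: "'a::comm_ring_1^'n^'n \<Rightarrow> bool" where
  "diagonal_matrix A \<longleftrightarrow> (\<forall>i j. i \<noteq> j \<longrightarrow> A $ i $ j = 0)"

definition tame :: "'a::comm_ring_1^'n^'n \<Rightarrow> bool" where
  "tame A \<longleftrightarrow> (\<exists>Bs. (\<forall>B\<in>set Bs. elementary_matrix B \<or> diagonal_matrix B \<and> invertible B) \<and>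
    A = foldr (**) Bs (mat 1))"

end

theory Submission
  imports Defs "HOL-Algebra.Free_Abelian_Groups"
begin

text \<open>\<open>R / [R, R]\<close> is the free \<open>\<int>[t\<^sup>\<plusminus>\<^sup>1]\<close>-module on the images of \<open>x\<^sub>1\<close> and \<open>x\<^sub>2\<close>, where \<open>t\<close> acts as
  conjugation by \<open>x\<^sub>3\<close>; hence \<open>M\<close> is the semidirect product of \<open>\<int>[t\<^sup>\<plusminus>\<^sup>1]\<^sup>2\<close> with \<open>\<int>\<close>. A pair of elements
  of \<open>R / [R, R]\<close> is a matrix with two rows, and its normal closure in \<open>M\<close> is the row space; so it
  is all of \<open>R / [R, R]\<close> iff the matrix is invertible. An AC-transformation multiplies the matrix
  on the left by an elementary or an invertible diagonal matrix. Conversely, every such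
  multiplication is a composition of AC-transformations, because the units of \<open>\<int>[t\<^sup>\<plusminus>\<^sup>1]\<close> are just
  the monomials \<open>\<plusminus>t\<^sup>n\<close>.\<close>

section \<open>Normal closures and AC-equivalence under isomorphisms\<close>

lemma (in group) normal_closure_normal:
  assumes "S \<subseteq> carrier G"
  shows "normal_closure G S \<lhd> G"
proof (rule normal_invI)
  show "subgroup (normal_closure G S) G"
    unfolding normal_closure_def
    by (rule subgroups_Inter) (use assms normal_self in \<open>auto simp: normal_imp_subgroup\<close>)
next
  fix x h assume "x \<in> carrier G" "h \<in> normal_closure G S"
  then show "x \<otimes> h \<otimes> inv x \<in> normal_closure G S"
    unfolding normal_closure_def by (auto intro: normal.inv_op_closed2)
qed

lemma normal_closure_incl: "S \<subseteq> normal_closure G S"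
  by (auto simp: normal_closure_def)

lemma normal_closure_minimal: "\<lbrakk>N \<lhd> G; S \<subseteq> N\<rbrakk> \<Longrightarrow> normal_closure G S \<subseteq> N"
  by (auto simp: normal_closure_def)

lemma (in group_hom) normal_vimage:
  assumes "N \<lhd> H"
  shows "{x \<in> carrier G. h x \<in> N} \<lhd> G"
proof (rule G.normal_invI)
  interpret N: normal N H by fact
  show "subgroup {x \<in> carrier G. h x \<in> N} G"
    by unfold_locales (auto simp: N.m_closed)
  fix x k assume "x \<in> carrier G" "k \<in> {x \<in> carrier G. h x \<in> N}"
  then show "x \<otimes> k \<otimes> inv x \<in> {x \<in> carrier G. h x \<in> N}"
    by (auto intro: N.inv_op_closed2)
qed

text \<open>An isomorphism carries normal subgroups to normal subgroups, and preimages of normal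
  subgroups are normal under any homomorphism. Minimality of the closure then gives one inclusion
  from each fact.\<close>

lemma normal_closure_iso_image:
  assumes "group G" "group H" "f \<in> iso G H" "S \<subseteq> carrier G"
  shows "normal_closure H (f ` S) = f ` normal_closure G S"
proof
  interpret group_hom G H f
    using assms by (auto simp: group_hom_def group_hom_axioms_def iso_def)
  have "f ` normal_closure G S \<lhd> H"
    by (rule iso_normal_subgroup[OF assms(3) G.is_group H.is_group G.normal_closure_normal[OF assms(4)]])
  then show "normal_closure H (f ` S) \<subseteq> f ` normal_closure G S"
    by (rule normal_closure_minimal) (rule image_mono[OF normal_closure_incl])
  have "normal_closure H (f ` S) \<lhd> H"
    by (rule H.normal_closure_normal) (use assms(4) in auto)
  then have "{x \<in> carrier G. f x \<in> normal_closure H (f ` S)} \<lhd> G"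
    by (rule normal_vimage)
  then have "normal_closure G S \<subseteq> {x \<in> carrier G. f x \<in> normal_closure H (f ` S)}"
    by (rule normal_closure_minimal) (use assms(4) normal_closure_incl[of "f ` S" H] in blast)
  then show "f ` normal_closure G S \<subseteq> normal_closure H (f ` S)"
    by blast
qed

section \<open>Transport of AC-equivalence along homomorphisms and isomorphisms\<close>

lemma (in group) ac_step_in_carrier:
  "ac_step G xs ys \<Longrightarrow> set xs \<subseteq> carrier G \<Longrightarrow> set ys \<subseteq> carrier G"
  by (induction rule: ac_step.induct)
    (auto dest!: subsetD[OF set_update_subset_insert] intro!: m_closed inv_closed)

lemma (in group_hom) ac_step_map:
  "ac_step G xs ys \<Longrightarrow> set xs \<subseteq> carrier G \<Longrightarrow> ac_step H (map h xs) (map h ys)"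
proof (induction rule: ac_step.induct)
  case (AC1 i ys j)
  then show ?case
    using ac_step.AC1[of i "map h ys" j H] by (simp add: map_update subset_iff)
next
  case (AC2 i ys)
  then show ?case
    using ac_step.AC2[of i "map h ys" H] by (simp add: map_update subset_iff)
next
  case (AC3 i ys g)
  then show ?case
    using ac_step.AC3[of i "map h ys" "h g" H] by (simp add: map_update subset_iff)
qed

lemma (in group_hom) ac_equivalent_map:
  assumes "ac_equivalent G xs ys" "set xs \<subseteq> carrier G"
  shows "ac_equivalent H (map h xs) (map h ys)"
proof -
  have "(ac_step G)\<^sup>*\<^sup>* xs ys"
    using assms(1) by (simp add: ac_equivalent_def)
  then have "set ys \<subseteq> carrier G \<and> (ac_step H)\<^sup>*\<^sup>* (map h xs) (map h ys)"
  proof (induction rule: rtranclp_induct)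
    case (step ys zs)
    then show ?case
      by (meson G.ac_step_in_carrier ac_step_map rtranclp.rtrancl_into_rtrancl)
  qed (use assms in auto)
  then show ?thesis
    by (simp add: ac_equivalent_def)
qed

text \<open>The group-theoretic side of the theorem for an arbitrary group and pair, isolated so
  that it can be moved between \<open>M3\<close> and its semidirect product model.\<close>

definition ac_trivial_pair :: "('a, 'b) monoid_scheme \<Rightarrow> 'a \<Rightarrow> 'a \<Rightarrow> bool" where
  "ac_trivial_pair G a b \<longleftrightarrow> (\<forall>Y'. Y' \<subseteq> carrier G \<and> card Y' = 2 \<and>
     normal_closure G Y' = normal_closure G {a, b} \<longrightarrow> ac_equivalent_sets G Y' {a, b})"

text \<open>A competing set in \<open>G\<close> is pushed forward along \<open>f\<close>, compared
  with the pair in \<open>H\<close>, and the resulting AC-chain is pulled back along the inverse of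
  \<open>f\<close>. One direction suffices, since it can be applied to the inverse as well.\<close>

lemma ac_trivial_pair_iso:
  assumes "group G" "group H" and f: "f \<in> iso G H" and ab: "a \<in> carrier G" "b \<in> carrier G"
    and H: "ac_trivial_pair H (f a) (f b)"
  shows "ac_trivial_pair G a b"
  unfolding ac_trivial_pair_def
proof (intro allI impI)
  fix Y assume Y: "Y \<subseteq> carrier G \<and> card Y = 2 \<and> normal_closure G Y = normal_closure G {a, b}"
  interpret G: group G by fact
  define g where "g = inv_into (carrier G) f"
  have inj: "inj_on f (carrier G)" and "f ` carrier G = carrier H"
    using f by (auto simp: iso_def bij_betw_def)
  have g: "g \<in> iso H G"
    unfolding g_def by (rule G.iso_set_sym) fact
  have gf: "g (f x) = x" if "x \<in> carrier G" for x
    using inj that by (simp add: g_def)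
  have inj_g: "inj_on g (carrier H)"
    using g by (simp add: iso_def bij_betw_def)
  interpret g: group_hom H G g
    using assms(1,2) g by (auto simp: group_hom_def group_hom_axioms_def iso_def)
  have fY: "f ` Y \<subseteq> carrier H" and fab: "f a \<in> carrier H" "f b \<in> carrier H"
    using Y ab \<open>f ` carrier G = carrier H\<close> by blast+
  have "normal_closure H (f ` Y) = normal_closure H (f ` {a, b})"
    using normal_closure_iso_image[OF assms(1,2) f, of Y]
      normal_closure_iso_image[OF assms(1,2) f, of "{a, b}"] Y ab
    by (metis empty_subsetI insert_subset)
  moreover have "card (f ` Y) = 2"
    using Y inj card_image inj_on_subset by metis
  ultimately have "ac_equivalent_sets H (f ` Y) {f a, f b}"
    using H fY unfolding ac_trivial_pair_def by (metis image_empty image_insert)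
  then obtain as bs where *: "distinct as" "set as = f ` Y" "distinct bs" "set bs = {f a, f b}"
      "ac_equivalent H as bs"
    by (auto simp: ac_equivalent_sets_def)
  have "ac_equivalent G (map g as) (map g bs)"
    by (rule g.ac_equivalent_map) (use * fY in auto)
  \<comment> \<open>Injectivity ensures that the pulled-back tuples still list their sets without
    repetition.\<close>
  moreover have "inj_on g (f ` Y)" "inj_on g {f a, f b}"
    by (rule inj_on_subset[OF inj_g], use fY fab in simp)+
  then have "distinct (map g as)" "distinct (map g bs)"
    unfolding distinct_map by (simp_all only: *)
  moreover have "g (f x) = x" if "x \<in> Y" for x
    using that Y gf by blast
  then have "g ` f ` Y = Y"
    unfolding image_image by simp
  then have "set (map g as) = Y"
    by (simp add: *(2))
  moreover have "set (map g bs) = {a, b}"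
    using * ab gf by simp
  ultimately show "ac_equivalent_sets G Y {a, b}"
    unfolding ac_equivalent_sets_def
    by (intro exI[of _ "map g as"] exI[of _ "map g bs"] conjI)
qed

lemma ac_equivalent_refl [simp]: "ac_equivalent G xs xs"
  by (simp add: ac_equivalent_def)

lemma ac_equivalent_trans [trans]:
  "ac_equivalent G xs ys \<Longrightarrow> ac_equivalent G ys zs \<Longrightarrow> ac_equivalent G xs zs"
  by (simp add: ac_equivalent_def)

lemma ac_step_equivalent: "ac_step G xs ys \<Longrightarrow> ac_equivalent G xs ys"
  by (simp add: ac_equivalent_def)

section \<open>Units of the Laurent polynomial ring\<close>

text \<open>With exponents in a group, \<open>l\<close> and \<open>k\<close> determine the second
  exponent, so the inner sum of the convolution has a single term.\<close>

lemma lookup_mult_group: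
  fixes f g :: "'a::ab_group_add \<Rightarrow>\<^sub>0 'b::semiring_0"
  shows "Poly_Mapping.lookup (f * g) k = (\<Sum>l. Poly_Mapping.lookup f l * Poly_Mapping.lookup g (k - l))"
proof -
  have "(\<Sum>q. Poly_Mapping.lookup g q when k = l + q) = Poly_Mapping.lookup g (k - l)" for l
  proof -
    have "k = l + q \<longleftrightarrow> q = k - l" for q
      by (auto simp: algebra_simps)
    then show ?thesis by simp
  qed
  then show ?thesis
    by (simp add: lookup_mult)
qed

text \<open>If \<open>a + b\<close> arises from the two supports in at most one way, nothing can
  cancel the term at \<open>a\<close>. This is meant for extremal exponents.\<close>

lemma lookup_mult_unique:
  fixes f g :: "'a::ab_group_add \<Rightarrow>\<^sub>0 'b::semiring_0"
  assumes "\<And>l m. \<lbrakk>l \<in> Poly_Mapping.keys f; m \<in> Poly_Mapping.keys g; l + m = a + b\<rbrakk> \<Longrightarrow> l = a"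
  shows "Poly_Mapping.lookup (f * g) (a + b) = Poly_Mapping.lookup f a * Poly_Mapping.lookup g b"
proof -
  have "Poly_Mapping.lookup f l * Poly_Mapping.lookup g (a + b - l) = 0" if "l \<noteq> a" for l
  proof (rule ccontr)
    assume "Poly_Mapping.lookup f l * Poly_Mapping.lookup g (a + b - l) \<noteq> 0"
    then have "l \<in> Poly_Mapping.keys f" "a + b - l \<in> Poly_Mapping.keys g"
      unfolding in_keys_iff by (metis mult_zero_left, metis mult_zero_right)
    then show False
      using assms[of l "a + b - l"] that by simp
  qed
  then have "{l. Poly_Mapping.lookup f l * Poly_Mapping.lookup g (a + b - l) \<noteq> 0} \<subseteq> {a}"
    by blast
  then have "(\<Sum>l. Poly_Mapping.lookup f l * Poly_Mapping.lookup g (a + b - l)) = (\<Sum>l\<in>{a}. Poly_Mapping.lookup f l * Poly_Mapping.lookup g (a + b - l))"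
    by (intro Sum_any.expand_superset) auto
  then show ?thesis
    by (simp add: lookup_mult_group)
qed

text \<open>The highest terms of \<open>f\<close> and \<open>g\<close> multiply to the highest term
  of \<open>f * g\<close>, and likewise the lowest, because the integers have no zero divisors. Both
  must be the constant term 1, so \<open>f\<close> has a single exponent and its coefficient is a
  unit of the integers.\<close>

lemma int_laurent_unit:
  fixes f g :: int_laurent
  assumes "f * g = 1"
  obtains n c where "f = Poly_Mapping.single n c" "c = 1 \<or> c = -1"
proof -
  have nz: "Poly_Mapping.keys f \<noteq> {}" "Poly_Mapping.keys g \<noteq> {}"
    using assms by auto
  have eq0: "a + b = 0 \<and> Poly_Mapping.lookup f a * Poly_Mapping.lookup g b = 1"
    if "a \<in> Poly_Mapping.keys f" "b \<in> Poly_Mapping.keys g" "\<And>l m. \<lbrakk>l \<in> Poly_Mapping.keys f; m \<in> Poly_Mapping.keys g; l + m = a + b\<rbrakk> \<Longrightarrow> l = a" for a b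
  proof -
    have *: "Poly_Mapping.lookup f a * Poly_Mapping.lookup g b = Poly_Mapping.lookup 1 (a + b)"
      using lookup_mult_unique[of f g a b] that assms by simp
    moreover have "Poly_Mapping.lookup f a * Poly_Mapping.lookup g b \<noteq> 0"
      using that by (simp add: in_keys_iff)
    ultimately show ?thesis
      by (auto simp: lookup_one when_def split: if_splits)
  qed
  have max: "Max (Poly_Mapping.keys f) + Max (Poly_Mapping.keys g) = 0 \<and> Poly_Mapping.lookup f (Max (Poly_Mapping.keys f)) * Poly_Mapping.lookup g (Max (Poly_Mapping.keys g)) = 1"
  proof (rule eq0)
    fix l m assume *: "l \<in> Poly_Mapping.keys f" "m \<in> Poly_Mapping.keys g" "l + m = Max (Poly_Mapping.keys f) + Max (Poly_Mapping.keys g)"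
    then have "l \<le> Max (Poly_Mapping.keys f)" "m \<le> Max (Poly_Mapping.keys g)"
      by simp_all
    then show "l = Max (Poly_Mapping.keys f)"
      using * by linarith
  qed (use nz in auto)
  have min: "Min (Poly_Mapping.keys f) + Min (Poly_Mapping.keys g) = 0 \<and> Poly_Mapping.lookup f (Min (Poly_Mapping.keys f)) * Poly_Mapping.lookup g (Min (Poly_Mapping.keys g)) = 1"
  proof (rule eq0)
    fix l m assume *: "l \<in> Poly_Mapping.keys f" "m \<in> Poly_Mapping.keys g" "l + m = Min (Poly_Mapping.keys f) + Min (Poly_Mapping.keys g)"
    then have "Min (Poly_Mapping.keys f) \<le> l" "Min (Poly_Mapping.keys g) \<le> m"
      by simp_all
    then show "l = Min (Poly_Mapping.keys f)"
      using * by linarith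
  qed (use nz in auto)
  let ?n = "Max (Poly_Mapping.keys f)"
  \<comment> \<open>The two maxima and the two minima both add up to 0, so neither support can have
    positive width.\<close>
  have "Min (Poly_Mapping.keys f) \<le> Max (Poly_Mapping.keys f)" "Min (Poly_Mapping.keys g) \<le> Max (Poly_Mapping.keys g)"
    using nz by (meson Max_in Min_le finite_keys)+
  then have "Min (Poly_Mapping.keys f) = ?n"
    using max min by linarith
  then have "k = ?n" if "k \<in> Poly_Mapping.keys f" for k
    using that by (metis Max_ge Min_le antisym finite_keys)
  then have "f = Poly_Mapping.single ?n (Poly_Mapping.lookup f ?n)"
    by (intro poly_mapping_eqI) (metis in_keys_iff lookup_single_eq lookup_single_not_eq)
  moreover have "Poly_Mapping.lookup f ?n = 1 \<or> Poly_Mapping.lookup f ?n = -1"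
    using max by (auto simp: zmult_eq_1_iff)
  ultimately show thesis ..
qed

section \<open>The semidirect product\<close>

text \<open>\<open>frag_of k\<close> abbreviates \<open>Poly_Mapping.single k 1\<close>, the monomial \<open>t\<^sup>k\<close>.\<close>

definition laurent_semidirect :: "((int_laurent^2) \<times> int) monoid" where
  "laurent_semidirect = \<lparr>carrier = UNIV,
     mult = (\<lambda>(v, k) (w, l). (v + frag_of k *s w, k + l)), one = (0, 0)\<rparr>"

lemma carrier_laurent_semidirect [simp]: "carrier laurent_semidirect = UNIV"
  by (simp add: laurent_semidirect_def)

lemma one_laurent_semidirect: "\<one>\<^bsub>laurent_semidirect\<^esub> = (0, 0)"
  by (simp add: laurent_semidirect_def)

lemma mult_laurent_semidirect [simp]:
  "(v, k) \<otimes>\<^bsub>laurent_semidirect\<^esub> (w, l) = (v + frag_of k *s w, k + l)"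
  by (simp add: laurent_semidirect_def)

lemma group_laurent_semidirect: "group laurent_semidirect"
proof (rule groupI)
  fix x y z
  show "x \<otimes>\<^bsub>laurent_semidirect\<^esub> y \<otimes>\<^bsub>laurent_semidirect\<^esub> z =
      x \<otimes>\<^bsub>laurent_semidirect\<^esub> (y \<otimes>\<^bsub>laurent_semidirect\<^esub> z)"
    by (cases x; cases y; cases z)
      (simp add: vector_add_ldistrib vector_smult_assoc mult_single add.assoc)
next
  fix x
  show "\<one>\<^bsub>laurent_semidirect\<^esub> \<otimes>\<^bsub>laurent_semidirect\<^esub> x = x"
    by (cases x) (simp add: one_laurent_semidirect)
  show "\<exists>y\<in>carrier laurent_semidirect. y \<otimes>\<^bsub>laurent_semidirect\<^esub> x = \<one>\<^bsub>laurent_semidirect\<^esub>"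
    by (rule bexI[of _ "(- (frag_of (- snd x) *s fst x), - snd x)"])
      (cases x; simp add: one_laurent_semidirect)+
qed auto

interpretation N: group laurent_semidirect
  by (rule group_laurent_semidirect)

lemma inv_laurent_semidirect [simp]:
  "inv\<^bsub>laurent_semidirect\<^esub> (v, k) = (- (frag_of (- k) *s v), - k)"
  by (rule N.inv_equality) (auto simp: one_laurent_semidirect)

text \<open>The monomials generate the Laurent polynomials additively, and
  \<open>frag_induction\<close> builds every element from them by differences, which a subgroup
  respects.\<close>

lemma laurent_smult_closed:
  assumes "subgroup C laurent_semidirect"
    and "\<And>n. (frag_of n *s x, 0) \<in> C"
  shows "(a *s x, 0) \<in> C"
proof -
  interpret C: subgroup C laurent_semidirect by fact
  have "Poly_Mapping.keys a \<subseteq> UNIV" by simp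
  then show ?thesis
  proof (induction a rule: frag_induction)
    case zero
    then show ?case
      using C.one_closed by (simp add: one_laurent_semidirect)
  next
    case (diff a b)
    then show ?case
      using C.m_closed[OF diff.IH(1) C.m_inv_closed[OF diff.IH(2)]]
      by (simp add: vector_sub_rdistrib)
  qed (use assms(2) in auto)
qed

text \<open>Conjugation by \<open>(u, n)\<close> acts on \<open>(x, 0)\<close> as multiplication by
  \<open>frag_of n\<close>: the vector \<open>u\<close> cancels. So a subgroup of the vectors is
  normal exactly when it is a submodule, and the closure is the row space.\<close>

lemma normal_closure_rows:
  "normal_closure laurent_semidirect {(v, 0), (w, 0)} = range (\<lambda>(a, b). (a *s v + b *s w, 0))"
proof
  let ?S = "range (\<lambda>(a, b). (a *s v + b *s w, 0 :: int))"
  have S: "(a *s v + b *s w, 0) \<in> ?S" for a b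
    by (rule range_eqI[of _ _ "(a, b)"]) simp
  have "?S \<lhd> laurent_semidirect"
  proof (rule N.normal_invI)
    show "subgroup ?S laurent_semidirect"
    proof
      show "\<one>\<^bsub>laurent_semidirect\<^esub> \<in> ?S"
        using S[of 0 0] by (simp add: one_laurent_semidirect)
    next
      fix x y assume "x \<in> ?S" "y \<in> ?S"
      then obtain a b c d where "x = (a *s v + b *s w, 0)" "y = (c *s v + d *s w, 0)"
        by auto
      then show "x \<otimes>\<^bsub>laurent_semidirect\<^esub> y \<in> ?S"
        using S[of "a + c" "b + d"] by (simp add: vector_sadd_rdistrib algebra_simps)
    next
      fix x assume "x \<in> ?S"
      then obtain a b where "x = (a *s v + b *s w, 0)"
        by auto
      then show "inv\<^bsub>laurent_semidirect\<^esub> x \<in> ?S"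
        using S[of "- a" "- b"] by (simp add: vector_smult_lneg)
    qed simp
    fix x h assume "x \<in> carrier laurent_semidirect" "h \<in> ?S"
    then obtain a b u n where h: "h = (a *s v + b *s w, 0)" and x: "x = (u, n)"
      by (cases x) auto
    show "x \<otimes>\<^bsub>laurent_semidirect\<^esub> h \<otimes>\<^bsub>laurent_semidirect\<^esub> inv\<^bsub>laurent_semidirect\<^esub> x \<in> ?S"
      using S[of "frag_of n * a" "frag_of n * b"]
      by (simp add: x h vector_add_ldistrib vector_smult_assoc vector_smult_rneg mult_single)
  qed
  moreover have "{(v, 0), (w, 0)} \<subseteq> ?S"
    using S[of 1 0] S[of 0 1] by simp
  ultimately show "normal_closure laurent_semidirect {(v, 0), (w, 0)} \<subseteq> ?S"
    by (rule normal_closure_minimal)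
next
  let ?C = "normal_closure laurent_semidirect {(v, 0), (w, 0)}"
  interpret C: normal ?C laurent_semidirect
    by (rule N.normal_closure_normal) simp
  have "(a *s x, 0) \<in> ?C" if x: "(x, 0) \<in> ?C" for a x
  proof (rule laurent_smult_closed[OF C.subgroup_axioms])
    show "(frag_of n *s x, 0) \<in> ?C" for n
      using C.inv_op_closed2[OF _ x, of "(0, n)"] by simp
  qed
  moreover have "(v, 0) \<in> ?C" "(w, 0) \<in> ?C"
    using normal_closure_incl[of "{(v, 0), (w, 0)}" laurent_semidirect] by auto
  ultimately have "(a *s v + b *s w, 0) \<in> ?C" for a b
    using C.m_closed[of "(a *s v, 0)" "(b *s w, 0)"] by simp
  then show "range (\<lambda>(a, b). (a *s v + b *s w, 0)) \<subseteq> ?C"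
    by auto
qed

lemma normal_closure_axes:
  "normal_closure laurent_semidirect {(axis 1 1, 0), (axis 2 1, 0)} = range (\<lambda>v. (v, 0))"
proof -
  have "v = v $ 1 *s axis 1 1 + v $ 2 *s axis 2 1" for v :: "int_laurent^2"
    by (simp add: vec_eq_iff forall_2 axis_def)
  then show ?thesis
    unfolding normal_closure_rows by (force simp: image_iff)
qed

section \<open>AC-equivalence and tame matrices\<close>

lemma ac_equivalent_invert_fst:
  "ac_equivalent laurent_semidirect [(v, 0), y] [(- v, 0), y]"
  using AC2[of 0 "[(v, 0), y]" laurent_semidirect] by (intro ac_step_equivalent) simp

lemma ac_equivalent_invert_snd:
  "ac_equivalent laurent_semidirect [y, (w, 0)] [y, (- w, 0)]"
  using AC2[of 1 "[y, (w, 0)]" laurent_semidirect] by (intro ac_step_equivalent) simp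

lemma ac_equivalent_shift_fst:
  "ac_equivalent laurent_semidirect [(v, 0), y] [(frag_of n *s v, 0), y]"
  using AC3[of 0 "[(v, 0), y]" "(0, n)" laurent_semidirect] by (intro ac_step_equivalent) simp

lemma ac_equivalent_shift_snd:
  "ac_equivalent laurent_semidirect [y, (w, 0)] [y, (frag_of n *s w, 0)]"
  using AC3[of 1 "[y, (w, 0)]" "(0, n)" laurent_semidirect] by (intro ac_step_equivalent) simp

text \<open>A unit is a monomial up to sign: the monomial comes from conjugation by
  \<open>(0, n)\<close>, the sign from inversion.\<close>

lemma ac_equivalent_unit_smult:
  assumes "c * d = (1 :: int_laurent)"
  shows "ac_equivalent laurent_semidirect [(v, 0), y] [(c *s v, 0), y]"
proof -
  obtain n e where c: "c = Poly_Mapping.single n e" and e: "e = 1 \<or> e = -1"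
    using int_laurent_unit[OF assms] .
  show ?thesis
  proof (cases "e = 1")
    case True
    then show ?thesis
      using ac_equivalent_shift_fst c by simp
  next
    case False
    then have "c = - frag_of n"
      using c e by (simp add: single_uminus)
    then show ?thesis
      using ac_equivalent_trans[OF ac_equivalent_shift_fst ac_equivalent_invert_fst, of v y n]
      by (simp add: vector_smult_lneg)
  qed
qed

text \<open>Additive induction on \<open>c\<close>. For a monomial, \<open>w\<close> is conjugated
  to its multiple, added to \<open>v\<close> and conjugated back. For a difference, the subtrahend
  is added with \<open>w\<close> temporarily negated.\<close>

lemma ac_equivalent_add_smult:
  "ac_equivalent laurent_semidirect [(v, 0), (w, 0)] [(v + c *s w, 0), (w, 0)]"
proof -
  have "Poly_Mapping.keys c \<subseteq> UNIV" by simp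
  \<comment> \<open>The vectors stay quantified because the second induction hypothesis is applied
    to \<open>v + a *s w\<close> and \<open>- w\<close>.\<close>
  then have "\<forall>v w. ac_equivalent laurent_semidirect [(v, 0), (w, 0)] [(v + c *s w, 0), (w, 0)]"
  proof (induction c rule: frag_induction)
    case (one n)
    show ?case
    proof (intro allI)
      fix v w
      have "ac_equivalent laurent_semidirect [(v, 0), (w, 0)] [(v, 0), (frag_of n *s w, 0)]"
        by (rule ac_equivalent_shift_snd)
      also have "ac_equivalent laurent_semidirect \<dots> [(v + frag_of n *s w, 0), (frag_of n *s w, 0)]"
        using AC1[of 0 "[(v, 0), (frag_of n *s w, 0)]" 1 laurent_semidirect]
        by (intro ac_step_equivalent) simp
      also have "ac_equivalent laurent_semidirect \<dots>
          [(v + frag_of n *s w, 0), (frag_of (- n) *s (frag_of n *s w), 0)]"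
        by (rule ac_equivalent_shift_snd)
      finally show "ac_equivalent laurent_semidirect [(v, 0), (w, 0)] [(v + frag_of n *s w, 0), (w, 0)]"
        by (simp add: vector_smult_assoc mult_single)
    qed
  next
    case (diff a b)
    show ?case
    proof (intro allI)
      fix v w
      have "ac_equivalent laurent_semidirect [(v, 0), (w, 0)] [(v + a *s w, 0), (w, 0)]"
        using diff.IH(1) by blast
      also have "ac_equivalent laurent_semidirect \<dots> [(v + a *s w, 0), (- w, 0)]"
        by (rule ac_equivalent_invert_snd)
      also have "ac_equivalent laurent_semidirect \<dots> [(v + a *s w + b *s (- w), 0), (- w, 0)]"
        using diff.IH(2) by blast
      also have "ac_equivalent laurent_semidirect \<dots> [(v + a *s w + b *s (- w), 0), (- (- w), 0)]"
        by (rule ac_equivalent_invert_snd)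
      finally show "ac_equivalent laurent_semidirect [(v, 0), (w, 0)] [(v + (a - b) *s w, 0), (w, 0)]"
        by (simp add: vector_smult_rneg vector_sub_rdistrib add_diff_eq)
    qed
  qed simp
  then show ?thesis by blast
qed

lemma matrix_mult_row_2:
  fixes B :: "'a::semiring_1^2^'m"
  shows "(B ** C) $ i = B $ i $ 1 *s C $ 1 + B $ i $ 2 *s C $ 2"
  by (simp add: vec_eq_iff matrix_matrix_mult_def sum_2)

text \<open>Left multiplication by an elementary matrix adds a multiple of one row to the other; by
  an invertible diagonal matrix, it scales the rows by units. Swaps reduce operations on the second
  row to operations on the first.\<close>

lemma ac_equivalent_rows_mult:
  fixes B C :: "int_laurent^2^2"
  assumes "elementary_matrix B \<or> diagonal_matrix B \<and> invertible B"
  shows "ac_equivalent laurent_semidirect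
    [(C $ 1, 0), (C $ 2, 0)] [((B ** C) $ 1, 0), ((B ** C) $ 2, 0)]"
  using assms
proof
  assume "elementary_matrix B"
  then obtain k l c where "k \<noteq> l" and B: "B = mat 1 + (\<chi> i j. if i = k \<and> j = l then c else 0)"
    by (auto simp: elementary_matrix_def)
  then consider "k = 1" "l = 2" | "k = 2" "l = 1"
    using exhaust_2[of k] exhaust_2[of l] by auto
  then show ?thesis
  proof cases
    case 1
    then have "(B ** C) $ 1 = C $ 1 + c *s C $ 2" "(B ** C) $ 2 = C $ 2"
      unfolding matrix_mult_row_2 by (auto simp: B mat_def)
    then show ?thesis
      using ac_equivalent_add_smult by simp
  next
    case 2
    then have BC: "(B ** C) $ 1 = C $ 1" "(B ** C) $ 2 = C $ 2 + c *s C $ 1"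
      unfolding matrix_mult_row_2 by (auto simp: B mat_def)
    have "ac_equivalent laurent_semidirect [(C $ 1, 0), (C $ 2, 0)] [(C $ 2, 0), (C $ 1, 0)]"
      by (rule ac_equivalent_swap) (auto simp: group_laurent_semidirect)
    also have "ac_equivalent laurent_semidirect \<dots> [(C $ 2 + c *s C $ 1, 0), (C $ 1, 0)]"
      by (rule ac_equivalent_add_smult)
    also have "ac_equivalent laurent_semidirect \<dots> [(C $ 1, 0), (C $ 2 + c *s C $ 1, 0)]"
      by (rule ac_equivalent_swap) (auto simp: group_laurent_semidirect)
    finally show ?thesis
      by (simp add: BC)
  qed
next
  assume B: "diagonal_matrix B \<and> invertible B"
  then obtain D where D: "B ** D = mat 1"
    by (auto simp: invertible_def)
  have 0: "B $ 1 $ 2 = 0" "B $ 2 $ 1 = 0"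
    using B by (auto simp: diagonal_matrix_def)
  \<comment> \<open>Since \<open>B\<close> is diagonal, the diagonal entries of
    \<open>B ** D\<close> are products of diagonal entries, so those of \<open>B\<close> are
    units.\<close>
  have "B $ i $ i * D $ i $ i = 1" for i
  proof -
    have "(B ** D) $ i $ i = 1"
      by (simp add: D mat_def)
    then show ?thesis
      using exhaust_2[of i] 0 by (auto simp: matrix_mult_row_2)
  qed
  then have units: "B $ 1 $ 1 * D $ 1 $ 1 = 1" "B $ 2 $ 2 * D $ 2 $ 2 = 1"
    by blast+
  have BC: "(B ** C) $ 1 = B $ 1 $ 1 *s C $ 1" "(B ** C) $ 2 = B $ 2 $ 2 *s C $ 2"
    unfolding matrix_mult_row_2 by (auto simp: 0)
  have "ac_equivalent laurent_semidirect [(C $ 1, 0), (C $ 2, 0)] [(B $ 1 $ 1 *s C $ 1, 0), (C $ 2, 0)]"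
    by (rule ac_equivalent_unit_smult[OF units(1)])
  also have "ac_equivalent laurent_semidirect \<dots> [(C $ 2, 0), (B $ 1 $ 1 *s C $ 1, 0)]"
    by (rule ac_equivalent_swap) (auto simp: group_laurent_semidirect)
  also have "ac_equivalent laurent_semidirect \<dots> [(B $ 2 $ 2 *s C $ 2, 0), (B $ 1 $ 1 *s C $ 1, 0)]"
    by (rule ac_equivalent_unit_smult[OF units(2)])
  also have "ac_equivalent laurent_semidirect \<dots> [(B $ 1 $ 1 *s C $ 1, 0), (B $ 2 $ 2 *s C $ 2, 0)]"
    by (rule ac_equivalent_swap) (auto simp: group_laurent_semidirect)
  finally show ?thesis
    by (simp add: BC)
qed

lemma ac_equivalent_rows_tame_mult:
  fixes B C :: "int_laurent^2^2"
  assumes "tame B"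
  shows "ac_equivalent laurent_semidirect
    [(C $ 1, 0), (C $ 2, 0)] [((B ** C) $ 1, 0), ((B ** C) $ 2, 0)]"
proof -
  obtain Bs where Bs: "\<forall>B\<in>set Bs. elementary_matrix B \<or> diagonal_matrix B \<and> invertible B"
    and B: "B = foldr (**) Bs (mat 1)"
    using assms by (auto simp: tame_def)
  from Bs have "ac_equivalent laurent_semidirect [(C $ 1, 0), (C $ 2, 0)]
      [((foldr (**) Bs (mat 1) ** C) $ 1, 0), ((foldr (**) Bs (mat 1) ** C) $ 2, 0)]"
  proof (induction Bs)
    case (Cons E Bs)
    then have "ac_equivalent laurent_semidirect [(C $ 1, 0), (C $ 2, 0)]
        [((foldr (**) Bs (mat 1) ** C) $ 1, 0), ((foldr (**) Bs (mat 1) ** C) $ 2, 0)]"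
      by simp
    also have "ac_equivalent laurent_semidirect \<dots>
        [((E ** (foldr (**) Bs (mat 1) ** C)) $ 1, 0), ((E ** (foldr (**) Bs (mat 1) ** C)) $ 2, 0)]"
      by (rule ac_equivalent_rows_mult) (use Cons.prems in auto)
    finally show ?case
      by (simp add: matrix_mul_assoc)
  qed simp
  then show ?thesis
    by (simp add: B)
qed

section \<open>Tameness under row operations and AC-transformations\<close>

definition matrix_rows2 :: "'a^'n \<Rightarrow> 'a^'n \<Rightarrow> 'a^'n^2" where
  "matrix_rows2 v w = (\<chi> i. if i = 1 then v else w)"

lemma matrix_rows2_nth [simp]:
  "matrix_rows2 v w $ 1 = v" "matrix_rows2 v w $ 2 = w"
  by (simp_all add: matrix_rows2_def)

lemma matrix_rows2_eq: "matrix_rows2 (A $ 1) (A $ 2) = A"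
  by (simp add: vec_eq_iff forall_2)

lemma matrix_rows2_axis: "matrix_rows2 (axis 1 1) (axis 2 1) = mat 1"
  by (simp add: vec_eq_iff forall_2 mat_def axis_def)

lemma tame_mat_1: "tame (mat 1)"
  unfolding tame_def by (rule exI[of _ "[]"]) simp

lemma tame_mult_generator:
  assumes "elementary_matrix B \<or> diagonal_matrix B \<and> invertible B" "tame C"
  shows "tame (B ** C)"
proof -
  obtain Bs where "\<forall>B\<in>set Bs. elementary_matrix B \<or> diagonal_matrix B \<and> invertible B"
    "C = foldr (**) Bs (mat 1)"
    using assms(2) by (auto simp: tame_def)
  then show ?thesis
    unfolding tame_def using assms(1) by (intro exI[of _ "B # Bs"]) simp
qed

lemma tame_add_row:
  fixes v w :: "'a::comm_ring_1^2"
  shows "tame (matrix_rows2 v w) \<Longrightarrow> tame (matrix_rows2 (v + c *s w) w)"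
    and "tame (matrix_rows2 v w) \<Longrightarrow> tame (matrix_rows2 v (w + c *s v))"
proof -
  have elem: "elementary_matrix (mat 1 + (\<chi> i j. if i = k \<and> j = l then c else 0) :: 'a^2^2)"
    if "k \<noteq> l" for k l
    using that unfolding elementary_matrix_def by blast
  assume C: "tame (matrix_rows2 v w)"
  have "matrix_rows2 (v + c *s w) w =
      (mat 1 + (\<chi> i j. if i = 1 \<and> j = 2 then c else 0)) ** matrix_rows2 v w"
    by (subst vec_eq_iff) (simp add: forall_2 matrix_mult_row_2 mat_def)
  then show "tame (matrix_rows2 (v + c *s w) w)"
    using tame_mult_generator[OF disjI1[OF elem] C] by simp
  have "matrix_rows2 v (w + c *s v) =
      (mat 1 + (\<chi> i j. if i = 2 \<and> j = 1 then c else 0)) ** matrix_rows2 v w"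
    by (subst vec_eq_iff) (simp add: forall_2 matrix_mult_row_2 mat_def)
  then show "tame (matrix_rows2 v (w + c *s v))"
    using tame_mult_generator[OF disjI1[OF elem] C] by simp
qed

lemma tame_smult_row:
  fixes v w :: "'a::comm_ring_1^2"
  assumes "a * b = 1" and C: "tame (matrix_rows2 v w)"
  shows "tame (matrix_rows2 (a *s v) w)" and "tame (matrix_rows2 v (a *s w))"
proof -
  define D :: "'a \<Rightarrow> 'a \<Rightarrow> 'a^2^2" where "D x y = matrix_rows2 (axis 1 x) (axis 2 y)" for x y
  have diag: "diagonal_matrix (D x y)" for x y
    by (auto simp: diagonal_matrix_def D_def forall_2 axis_def)
  have mult: "D x y ** matrix_rows2 p q = matrix_rows2 (x *s p) (y *s q)" for x y p q
    by (subst vec_eq_iff) (simp add: forall_2 matrix_mult_row_2 D_def axis_def)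
  have D_mult: "D x y ** D x' y' = D (x * x') (y * y')" for x y x' y'
    unfolding D_def[of x'] mult by (simp add: D_def vec_eq_iff forall_2 axis_def)
  have D_1: "D 1 1 = mat 1"
    by (simp add: D_def matrix_rows2_axis)
  \<comment> \<open>The inverses are the diagonal matrices with \<open>b\<close> in place of
    \<open>a\<close>.\<close>
  have "invertible (D a 1)" "invertible (D 1 a)"
    unfolding invertible_def using assms(1)
    by (intro exI[of _ "D b 1"], simp add: D_mult D_1 mult.commute,
        intro exI[of _ "D 1 b"], simp add: D_mult D_1 mult.commute)
  then have "tame (D a 1 ** matrix_rows2 v w)" "tame (D 1 a ** matrix_rows2 v w)"
    using tame_mult_generator[OF _ C] diag by blast+
  then show "tame (matrix_rows2 (a *s v) w)" and "tame (matrix_rows2 v (a *s w))"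
    by (simp_all add: mult)
qed

text \<open>Each AC-transformation of vectors is a row operation whose inverse is again one, so
  tameness passes backwards along it. Backwards is the useful direction, because the chains
  considered end at the identity matrix. The form of \<open>zs\<close> is recorded so that the
  argument can be iterated.\<close>

lemma ac_step_tame:
  assumes "ac_step laurent_semidirect [(v, 0), (w, 0)] zs"
  shows "\<exists>v' w'. zs = [(v', 0), (w', 0)] \<and>
    (tame (matrix_rows2 v' w') \<longrightarrow> tame (matrix_rows2 v w))"
  using assms
proof cases
  case (AC1 i j)
  then consider "i = 0" "j = 1" | "i = 1" "j = 0"
    by (auto simp: less_Suc_eq)
  then show ?thesis
  proof cases
    case 1
    have "tame (matrix_rows2 v w)" if "tame (matrix_rows2 (v + w) w)"
      using tame_add_row(1)[OF that, of "- 1"] by (simp add: vector_smult_lneg)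
    then show ?thesis
      using AC1 1 by auto
  next
    case 2
    have "tame (matrix_rows2 v w)" if "tame (matrix_rows2 v (w + v))"
      using tame_add_row(2)[OF that, of "- 1"] by (simp add: vector_smult_lneg)
    then show ?thesis
      using AC1 2 by auto
  qed
next
  case (AC2 i)
  then consider "i = 0" | "i = 1"
    by (auto simp: less_Suc_eq)
  then show ?thesis
  proof cases
    case 1
    have "tame (matrix_rows2 v w)" if "tame (matrix_rows2 (- v) w)"
      using tame_smult_row(1)[OF _ that, of "- 1" "- 1"] by (simp add: vector_smult_lneg)
    then show ?thesis
      using AC2 1 by auto
  next
    case 2
    have "tame (matrix_rows2 v w)" if "tame (matrix_rows2 v (- w))"
      using tame_smult_row(2)[OF _ that, of "- 1" "- 1"] by (simp add: vector_smult_lneg)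
    then show ?thesis
      using AC2 2 by auto
  qed
next
  case (AC3 i g)
  obtain u n where g: "g = (u, n)"
    by (cases g)
  have units: "frag_of (- n) * frag_of n = (1 :: int_laurent)"
    by (simp add: mult_single)
  consider "i = 0" | "i = 1"
    using AC3 by (auto simp: less_Suc_eq)
  then show ?thesis
  proof cases
    case 1
    have "tame (matrix_rows2 v w)" if "tame (matrix_rows2 (frag_of n *s v) w)"
      using tame_smult_row(1)[OF units that] by (simp add: vector_smult_assoc mult_single)
    then show ?thesis
      using AC3 1 by (auto simp: g vector_smult_assoc mult_single vector_smult_rneg)
  next
    case 2
    have "tame (matrix_rows2 v w)" if "tame (matrix_rows2 v (frag_of n *s w))"
      using tame_smult_row(2)[OF units that] by (simp add: vector_smult_assoc mult_single)
    then show ?thesis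
      using AC3 2 by (auto simp: g vector_smult_assoc mult_single vector_smult_rneg)
  qed
qed

lemma ac_equivalent_tame:
  assumes "ac_equivalent laurent_semidirect [(v, 0), (w, 0)] [(v', 0), (w', 0)]"
    and "tame (matrix_rows2 v' w')"
  shows "tame (matrix_rows2 v w)"
proof -
  have "(ac_step laurent_semidirect)\<^sup>*\<^sup>* [(v, 0), (w, 0)] [(v', 0), (w', 0)]"
    using assms(1) by (simp add: ac_equivalent_def)
  moreover have "\<exists>v' w'. zs = [(v', 0), (w', 0)] \<and>
      (tame (matrix_rows2 v' w') \<longrightarrow> tame (matrix_rows2 v w))"
    if "(ac_step laurent_semidirect)\<^sup>*\<^sup>* [(v, 0), (w, 0)] zs" for zs
    using that by (induction rule: rtranclp_induct) (simp, metis ac_step_tame)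
  ultimately show ?thesis
    using assms(2) by fastforce
qed

text \<open>\<open>det B\<close> inverts \<open>det A\<close>, so \<open>det B\<close> times the
  adjugate of \<open>A\<close> is a right inverse of \<open>A\<close>, and it must coincide with the
  left inverse \<open>B\<close>. Generation of the row space yields a left inverse only, whereas
  \<open>invertible\<close> asks for a two-sided one.\<close>

lemma matrix_left_inverse_imp_right_inverse_2:
  fixes A B :: "'a::comm_ring_1^2^2"
  assumes "B ** A = mat 1"
  shows "A ** B = mat 1"
proof -
  define adj :: "'a^2^2" where
    "adj = matrix_rows2 (vector [A $ 2 $ 2, - A $ 1 $ 2]) (vector [- A $ 2 $ 1, A $ 1 $ 1])"
  define C where "C = (\<chi> i. det B *s adj $ i)"
  have "det B * det A = 1"
    using assms by (metis det_I det_mul)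
  then have "A ** C = mat 1"
    by (simp add: vec_eq_iff forall_2 matrix_matrix_mult_def sum_2 mat_def C_def adj_def det_2
        algebra_simps)
  moreover from this have "B = C"
    using assms by (metis matrix_mul_assoc matrix_mul_lid matrix_mul_rid)
  ultimately show ?thesis by simp
qed

text \<open>The elements of \<open>Y\<close> are the rows of a matrix whose row space is everything,
  so some \<open>B\<close> multiplies it to the identity. It is \<open>B\<close> that is taken to be
  tame: its factors then give the AC-transformations from \<open>Y\<close> to the standard
  basis.\<close>

lemma tame_imp_ac_trivial:
  assumes "\<forall>A :: int_laurent^2^2. invertible A \<longrightarrow> tame A"
  shows "ac_trivial_pair laurent_semidirect (axis 1 1, 0) (axis 2 1, 0)"
  unfolding ac_trivial_pair_def
proof (intro allI impI)
  fix Y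
  assume Y: "Y \<subseteq> carrier laurent_semidirect \<and> card Y = 2 \<and>
    normal_closure laurent_semidirect Y =
      normal_closure laurent_semidirect {(axis 1 1, 0), (axis 2 1, 0)}"
  then have closure: "normal_closure laurent_semidirect Y = range (\<lambda>v. (v, 0))"
    by (simp add: normal_closure_axes)
  obtain y z where yz: "Y = {y, z}" "y \<noteq> z"
    using Y by (auto simp: card_2_iff)
  then have "y \<in> range (\<lambda>v. (v, 0))" "z \<in> range (\<lambda>v. (v, 0))"
    using normal_closure_incl[of Y laurent_semidirect] closure by auto
  then obtain v w where vw: "y = (v, 0)" "z = (w, 0)"
    by auto
  have "\<exists>a b. axis i 1 = a *s v + b *s w" for i :: 2
  proof -
    have "(axis i 1, 0) \<in> normal_closure laurent_semidirect Y"
      by (simp add: closure)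
    then show ?thesis
      unfolding yz vw normal_closure_rows by auto
  qed
  then obtain a b where ab: "\<And>i. axis i 1 = a i *s v + b i *s w"
    by metis
  \<comment> \<open>Row \<open>i\<close> of \<open>B\<close> holds the coefficients expressing the
    \<open>i\<close>-th basis vector in \<open>v\<close> and \<open>w\<close>.\<close>
  define B :: "int_laurent^2^2" where "B = (\<chi> i. vector [a i, b i])"
  have BA: "B ** matrix_rows2 v w = mat 1"
    unfolding matrix_rows2_axis[symmetric]
    by (subst vec_eq_iff) (simp add: forall_2 matrix_mult_row_2 B_def ab)
  then have "tame B"
    using assms matrix_left_inverse_imp_right_inverse_2[OF BA] unfolding invertible_def by blast
  then have "ac_equivalent laurent_semidirect [y, z]
      [((B ** matrix_rows2 v w) $ 1, 0), ((B ** matrix_rows2 v w) $ 2, 0)]"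
    using ac_equivalent_rows_tame_mult[of B "matrix_rows2 v w"] by (simp add: vw)
  also have "\<dots> = [(axis 1 1, 0), (axis 2 1, 0)]"
    unfolding BA matrix_rows2_axis[symmetric] by simp
  finally show "ac_equivalent_sets laurent_semidirect Y {(axis 1 1, 0), (axis 2 1, 0)}"
    unfolding ac_equivalent_sets_def using yz
    by (intro exI[of _ "[y, z]"] exI[of _ "[(axis 1 1, 0), (axis 2 1, 0)]"] conjI)
      (simp_all add: axis_eq_axis)
qed

section \<open>From AC-equivalence back to tame matrices\<close>

lemma distinct_set_pair: "distinct xs \<Longrightarrow> set xs = {a, b} \<Longrightarrow> a \<noteq> b \<Longrightarrow> xs = [a, b] \<or> xs = [b, a]"
proof -
  assume *: "distinct xs" "set xs = {a, b}" "a \<noteq> b"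
  then have "length xs = 2"
    using distinct_card[of xs] by simp
  then obtain c d where "xs = [c, d]"
    by (auto simp: numeral_2_eq_2 length_Suc_conv)
  then show ?thesis
    using * by (auto simp: doubleton_eq_iff)
qed

lemma ac_equivalent_sets_pair:
  assumes "group G" "ac_equivalent_sets G {a, b} {c, d}" "a \<noteq> b" "c \<noteq> d"
    "{a, b, c, d} \<subseteq> carrier G"
  shows "ac_equivalent G [a, b] [c, d]"
proof -
  obtain xs ys where *: "distinct xs" "set xs = {a, b}" "distinct ys" "set ys = {c, d}"
      "ac_equivalent G xs ys"
    using assms(2) by (auto simp: ac_equivalent_sets_def)
  have "ac_equivalent G [a, b] xs" "ac_equivalent G ys [c, d]"
    using distinct_set_pair[OF *(1,2) assms(3)] distinct_set_pair[OF *(3,4) assms(4)] assms(1,5)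
    by (auto intro: ac_equivalent_swap)
  then show ?thesis
    using *(5) ac_equivalent_trans by metis
qed

text \<open>The rows of an invertible matrix span all vectors, so they are AC-equivalent to the
  standard basis, and tameness of the identity is carried back to \<open>A\<close>.\<close>

lemma ac_trivial_imp_tame:
  fixes A :: "int_laurent^2^2"
  assumes triv: "ac_trivial_pair laurent_semidirect (axis 1 1, 0) (axis 2 1, 0)"
    and "invertible A"
  shows "tame A"
proof -
  obtain B where BA: "B ** A = mat 1"
    using assms(2) by (auto simp: invertible_def)
  have axis: "axis i 1 = B $ i $ 1 *s A $ 1 + B $ i $ 2 *s A $ 2" for i
    unfolding matrix_mult_row_2[symmetric] BA by (simp add: vec_eq_iff mat_def axis_def)
  \<comment> \<open>The rows must form a set of two elements; equal rows would give determinant 0,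
    which is not a unit.\<close>
  have ne: "A $ 1 \<noteq> A $ 2"
  proof
    assume "A $ 1 = A $ 2"
    then have "det A = 0"
      by (simp add: det_2 mult.commute)
    moreover have "det B * det A = 1"
      using BA by (metis det_I det_mul)
    ultimately show False by simp
  qed
  let ?C = "normal_closure laurent_semidirect {(A $ 1, 0), (A $ 2, 0)}"
  interpret C: normal ?C laurent_semidirect
    by (rule N.normal_closure_normal) simp
  have "{(axis 1 1, 0), (axis 2 1, 0)} \<subseteq> ?C"
    unfolding normal_closure_rows axis by auto
  then have "range (\<lambda>v. (v, 0)) \<subseteq> ?C"
    using normal_closure_minimal[OF C.normal_axioms] by (simp add: normal_closure_axes[symmetric])
  moreover have "?C \<subseteq> range (\<lambda>v. (v, 0))"
    unfolding normal_closure_rows by auto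
  ultimately have "?C = normal_closure laurent_semidirect {(axis 1 1, 0), (axis 2 1, 0)}"
    by (simp add: normal_closure_axes)
  moreover have "card {(A $ 1, 0 :: int), (A $ 2, 0)} = 2"
    using ne by simp
  ultimately have "ac_equivalent_sets laurent_semidirect {(A $ 1, 0), (A $ 2, 0)}
      {(axis 1 1, 0), (axis 2 1, 0)}"
    using triv unfolding ac_trivial_pair_def by simp
  then have "ac_equivalent laurent_semidirect [(A $ 1, 0), (A $ 2, 0)] [(axis 1 1, 0), (axis 2 1, 0)]"
    by (rule ac_equivalent_sets_pair[OF group_laurent_semidirect])
      (use ne in \<open>auto simp: axis_eq_axis\<close>)
  then have "tame (matrix_rows2 (A $ 1) (A $ 2))"
    by (rule ac_equivalent_tame) (simp add: matrix_rows2_axis tame_mat_1)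
  then show ?thesis
    by (simp add: matrix_rows2_eq)
qed

section \<open>The isomorphism between \<open>M\<close> and the semidirect product\<close>

lemma (in group_hom) hom_eq_on_generate:
  assumes "group_hom G H f" "S \<subseteq> carrier G" "\<And>x. x \<in> S \<Longrightarrow> h x = f x" "x \<in> generate G S"
  shows "h x = f x"
proof -
  interpret f: group_hom G H f by fact
  show ?thesis
    using assms(4)
  proof (induction rule: generate.induct)
    case (inv x)
    then show ?case using assms(2,3) by (auto simp: subset_iff)
  next
    case (eng x y)
    then show ?case using G.generate_in_carrier[OF assms(2)] by simp
  qed (use assms(3) in auto)
qed

lemma hom_free_Abelian_group_eq:
  assumes "group H" "h \<in> hom (free_Abelian_group UNIV) H" "h' \<in> hom (free_Abelian_group UNIV) H"
    and "\<And>n. h (frag_of n) = h' (frag_of n)"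
  shows "h c = h' c"
proof -
  interpret h: group_hom "free_Abelian_group UNIV" H h
    using assms by (simp add: group_hom_def group_hom_axioms_def)
  interpret h': group_hom "free_Abelian_group UNIV" H h'
    using assms by (simp add: group_hom_def group_hom_axioms_def)
  have "Poly_Mapping.keys c \<subseteq> UNIV" by simp
  then show ?thesis
  proof (induction c rule: frag_induction)
    case zero
    then show ?case using h.hom_one h'.hom_one by simp
  next
    case (diff a b)
    have "h (a - b) = h a \<otimes>\<^bsub>H\<^esub> inv\<^bsub>H\<^esub> h b" "h' (a - b) = h' a \<otimes>\<^bsub>H\<^esub> inv\<^bsub>H\<^esub> h' b"
      using h.hom_mult[of a "- b"] h.hom_inv[of b] h'.hom_mult[of a "- b"] h'.hom_inv[of b] by simp_all
    then show ?case using diff by simp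
  qed (use assms(4) in auto)
qed

text \<open>Conjugation by \<open>t\<close> turns the abelian normal subgroup \<open>B\<close> into
  a module over the Laurent polynomials. The homomorphism sends the basis vectors to
  \<open>b1\<close> and \<open>b2\<close> by linearity and \<open>(0, n)\<close> to the
  \<open>n\<close>-th power of \<open>t\<close>.\<close>

lemma (in group) laurent_semidirect_hom_exists:
  assumes "B \<lhd> G" and comm: "\<And>x y. \<lbrakk>x \<in> B; y \<in> B\<rbrakk> \<Longrightarrow> x \<otimes> y = y \<otimes> x"
    and b: "b1 \<in> B" "b2 \<in> B" and t: "t \<in> carrier G"
  shows "\<exists>h\<in>hom laurent_semidirect G. h (axis 1 1, 0) = b1 \<and> h (axis 2 1, 0) = b2 \<and> h (0, 1) = t"
proof -
  interpret B: normal B G by fact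
  interpret GB: comm_group "G\<lparr>carrier := B\<rparr>"
    by (rule group.group_comm_groupI[OF B.subgroup_is_group[OF is_group]]) (simp add: comm)
  have cancel: "inv x \<otimes> (x \<otimes> y) = y" if "x \<in> carrier G" "y \<in> carrier G" for x y
    using that by (simp add: m_assoc[symmetric])
  define conj where "conj n x = t [^] n \<otimes> x \<otimes> inv (t [^] n)" for n :: int and x
  have conj_B: "conj n x \<in> B" if "x \<in> B" for n x
    unfolding conj_def using that t by (intro B.inv_op_closed2) auto
  have conj_mult: "conj n (x \<otimes> y) = conj n x \<otimes> conj n y" if "x \<in> B" "y \<in> B" for n x y
  proof -
    have "x \<in> carrier G" "y \<in> carrier G"
      using that B.subset by auto
    then show ?thesis
      unfolding conj_def using t by (simp add: m_assoc cancel)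
  qed
  have conj_conj: "conj m (conj n x) = conj (m + n) x" if "x \<in> B" for m n x
    using that t by (simp add: conj_def B.mem_carrier m_assoc int_pow_mult inv_mult_group)
  \<comment> \<open>The additive group of Laurent polynomials is free abelian on the exponents, so
    \<open>q\<close> is the scalar action on \<open>b\<close>, prescribed on monomials.\<close>
  have "\<exists>q\<in>hom (free_Abelian_group UNIV) (G\<lparr>carrier := B\<rparr>). \<forall>n. q (frag_of n) = conj n b"
    if "b \<in> B" for b
  proof -
    have "range (\<lambda>n. conj n b) \<subseteq> carrier (G\<lparr>carrier := B\<rparr>)"
      using conj_B[OF that] by auto
    then obtain q where "q \<in> hom (free_Abelian_group UNIV) (G\<lparr>carrier := B\<rparr>)"
      "\<And>n. n \<in> UNIV \<Longrightarrow> q (frag_of n) = conj n b"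
      using GB.free_Abelian_group_universal by blast
    then show ?thesis by auto
  qed
  then obtain q where q: "\<And>b. b \<in> B \<Longrightarrow> q b \<in> hom (free_Abelian_group UNIV) (G\<lparr>carrier := B\<rparr>)"
    and q_frag: "\<And>b n. b \<in> B \<Longrightarrow> q b (frag_of n) = conj n b"
    by metis
  have q_B: "q b x \<in> B" if "b \<in> B" for b x
    using hom_in_carrier[OF q[OF that], of x] by simp
  have q_add: "q b (x + y) = q b x \<otimes> q b y" if "b \<in> B" for b x y
    using hom_mult[OF q[OF that], of x y] by simp
  have q_0: "q b 0 = \<one>" if "b \<in> B" for b
    using q_add[OF that, of 0 0] q_B[OF that, of 0] B.mem_carrier by simp
  \<comment> \<open>Both sides are additive in \<open>x\<close>, so comparing them on monomials
    suffices.\<close>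
  have q_conj: "q b (frag_of n * x) = conj n (q b x)" if "b \<in> B" for b n x
  proof (rule hom_free_Abelian_group_eq[of "G\<lparr>carrier := B\<rparr>"])
    show "(\<lambda>x. q b (frag_of n * x)) \<in> hom (free_Abelian_group UNIV) (G\<lparr>carrier := B\<rparr>)"
      using that by (intro homI) (auto simp: q_B q_add distrib_left)
    show "(\<lambda>x. conj n (q b x)) \<in> hom (free_Abelian_group UNIV) (G\<lparr>carrier := B\<rparr>)"
      using that by (intro homI) (auto simp: q_B q_add conj_B conj_mult)
    show "q b (frag_of n * frag_of m) = conj n (q b (frag_of m))" for m
      using that by (simp add: mult_single q_frag conj_conj)
  qed (rule GB.is_group)
  define h where "h = (\<lambda>(v :: int_laurent^2, n :: int). q b1 (v $ 1) \<otimes> q b2 (v $ 2) \<otimes> t [^] n)"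
  have "h \<in> hom laurent_semidirect G"
  proof (rule homI)
    fix x y :: "(int_laurent^2) \<times> int"
    obtain v m w n where xy: "x = (v, m)" "y = (w, n)"
      by (cases x; cases y)
    let ?q = "\<lambda>v. q b1 (v $ 1) \<otimes> q b2 (v $ 2)"
    have q_in: "?q v \<in> B" for v
      using q_B b by (simp add: B.m_closed)
    have "?q (v + frag_of m *s w) =
        (q b1 (v $ 1) \<otimes> conj m (q b1 (w $ 1))) \<otimes> (q b2 (v $ 2) \<otimes> conj m (q b2 (w $ 2)))"
      using b by (simp add: q_add q_conj)
    also have "\<dots> = ?q v \<otimes> (conj m (q b1 (w $ 1)) \<otimes> conj m (q b2 (w $ 2)))"
      using GB.m_ac q_B conj_B b B.m_closed by simp
    also have "\<dots> = ?q v \<otimes> conj m (?q w)"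
      using q_B b by (simp add: conj_mult)
    finally have "h (x \<otimes>\<^bsub>laurent_semidirect\<^esub> y) = ?q v \<otimes> conj m (?q w) \<otimes> t [^] (m + n)"
      by (simp add: h_def xy)
    also have "\<dots> = ?q v \<otimes> (t [^] m \<otimes> ?q w \<otimes> inv (t [^] m)) \<otimes> (t [^] m \<otimes> t [^] n)"
      using t by (simp add: conj_def int_pow_mult)
    also have "\<dots> = ?q v \<otimes> t [^] m \<otimes> (?q w \<otimes> t [^] n)"
      using B.mem_carrier[OF q_in[of v]] B.mem_carrier[OF q_in[of w]] t
      by (simp add: m_assoc cancel)
    finally show "h (x \<otimes>\<^bsub>laurent_semidirect\<^esub> y) = h x \<otimes> h y"
      by (simp add: h_def xy)
  next
    fix x
    show "h x \<in> carrier G"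
      using q_B b t by (cases x) (auto simp: h_def B.mem_carrier)
  qed
  moreover have "q b 1 = b" if "b \<in> B" for b
    using q_frag[OF that, of 0] B.mem_carrier[OF that] by (simp add: conj_def)
  then have "h (axis 1 1, 0) = b1" "h (axis 2 1, 0) = b2" "h (0, 1) = t"
    using b t B.mem_carrier by (simp_all add: h_def axis_def q_0)
  ultimately show ?thesis by blast
qed

text \<open>Conjugating by powers of \<open>(0, 1)\<close> gives all monomial multiples of the basis
  vectors, hence all vectors, and \<open>(v, n)\<close> is the product of \<open>(v, 0)\<close> and
  \<open>(0, n)\<close>.\<close>

lemma subgroup_laurent_semidirect_eq_UNIV:
  assumes "subgroup C laurent_semidirect" "(axis 1 1, 0) \<in> C" "(axis 2 1, 0) \<in> C" "(0, 1) \<in> C"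
  shows "C = UNIV"
proof -
  interpret C: subgroup C laurent_semidirect by fact
  have t: "(0, n) \<in> C" for n
  proof (induction n rule: int_induct[of _ 0])
    case base
    then show ?case
      using C.one_closed by (simp add: one_laurent_semidirect)
  next
    case (step1 i)
    then show ?case
      using C.m_closed[OF step1(2) assms(4)] by simp
  next
    case (step2 i)
    then show ?case
      using C.m_closed[OF step2(2) C.m_inv_closed[OF assms(4)]] by simp
  qed
  have smult: "(a *s x, 0) \<in> C" if "(x, 0) \<in> C" for a x
  proof (rule laurent_smult_closed[OF assms(1)])
    fix n
    show "(frag_of n *s x, 0) \<in> C"
      using C.m_closed[OF C.m_closed[OF t[of n] that] t[of "- n"]] by simp
  qed
  have "(v, n) \<in> C" for v n
  proof -
    have "v = v $ 1 *s axis 1 1 + v $ 2 *s axis 2 1"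
      by (simp add: vec_eq_iff forall_2 axis_def)
    then show ?thesis
      using C.m_closed[OF C.m_closed[OF smult[OF assms(2), of "v $ 1"] smult[OF assms(3), of "v $ 2"]] t[of n]]
      by simp
  qed
  then show ?thesis by auto
qed

lemma group_M3: "group M3"
proof -
  interpret F: group F3
    unfolding F3_def by (rule group_free_group)
  have "R3 \<lhd> F3"
    unfolding R3_def by (rule F.normal_closure_normal) (auto simp: F3_def intro: free_gen_in_carrier)
  then show ?thesis
    unfolding M3_def by (rule normal.factorgroup_is_group[OF F.derived_is_normal])
qed

text \<open>Freeness of \<open>F3\<close> gives \<phi> onto the semidirect product; the universal
  property of the latter gives \<psi> into \<open>M3\<close>. Their composite is the projection, as
  seen on generators. As \<phi> kills [R, R], it descends to \<open>f\<close>, which is injective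
  with left inverse \<psi> and surjective with \<phi>.\<close>

lemma M3_iso_laurent_semidirect:
  "\<exists>f\<in>iso M3 laurent_semidirect.
    f (proj_M3 (free_gen 1)) = (axis 1 1, 0) \<and> f (proj_M3 (free_gen 2)) = (axis 2 1, 0)"
proof -
  interpret F: group F3
    unfolding F3_def by (rule group_free_group)
  have gen: "free_gen i \<in> carrier F3" if "i \<in> {1, 2, 3}" for i
    unfolding F3_def using that by (rule free_gen_in_carrier)
  have "R3 \<lhd> F3"
    unfolding R3_def by (rule F.normal_closure_normal) (use gen in auto)
  then interpret R: normal R3 F3 .
  interpret D: normal "derived F3 R3" F3
    by (rule F.derived_is_normal) fact
  interpret M: group M3
    by (rule group_M3)
  have "proj_M3 \<in> hom F3 M3"
    unfolding M3_def proj_M3_def[abs_def] by (rule D.r_coset_hom_Mod)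
  then interpret p: group_hom F3 M3 proj_M3
    by (simp add: group_hom_def group_hom_axioms_def)
  have p_surj: "proj_M3 ` carrier F3 = carrier M3"
    unfolding M3_def proj_M3_def[abs_def] carrier_FactGroup ..
  have R_gen: "free_gen 1 \<in> R3" "free_gen 2 \<in> R3"
    unfolding R3_def using normal_closure_incl[of "{free_gen 1, free_gen 2}" F3] by simp_all
  have "proj_M3 ` R3 \<lhd> M3"
    by (rule R.surj_hom_normal_subgroup[OF p.group_hom_axioms p_surj])
  \<comment> \<open>The image of R is abelian because commutators of elements of R become trivial in
    \<open>M3\<close>.\<close>
  moreover have "x \<otimes>\<^bsub>M3\<^esub> y = y \<otimes>\<^bsub>M3\<^esub> x" if xy: "x \<in> proj_M3 ` R3" "y \<in> proj_M3 ` R3" for x y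
  proof -
    obtain r s where rs: "r \<in> R3" "s \<in> R3" "x = proj_M3 r" "y = proj_M3 s"
      using xy by auto
    note [simp] = R.mem_carrier[OF rs(1)] R.mem_carrier[OF rs(2)]
    let ?c = "r \<otimes>\<^bsub>F3\<^esub> s \<otimes>\<^bsub>F3\<^esub> inv\<^bsub>F3\<^esub> r \<otimes>\<^bsub>F3\<^esub> inv\<^bsub>F3\<^esub> s"
    have "?c \<in> derived F3 R3"
      unfolding derived_def using rs by (intro generate.incl) blast
    then have "proj_M3 ?c = \<one>\<^bsub>M3\<^esub>"
      unfolding proj_M3_def M3_def one_FactGroup by (rule D.rcos_const[OF F.is_group])
    then have "x \<otimes>\<^bsub>M3\<^esub> y \<otimes>\<^bsub>M3\<^esub> inv\<^bsub>M3\<^esub> x \<otimes>\<^bsub>M3\<^esub> inv\<^bsub>M3\<^esub> y = \<one>\<^bsub>M3\<^esub>"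
      by (simp add: rs)
    then have "x \<otimes>\<^bsub>M3\<^esub> y \<otimes>\<^bsub>M3\<^esub> inv\<^bsub>M3\<^esub> (y \<otimes>\<^bsub>M3\<^esub> x) = \<one>\<^bsub>M3\<^esub>"
      by (simp add: rs M.inv_mult_group M.m_assoc)
    then show ?thesis
      using M.inv_solve_right'[of "\<one>\<^bsub>M3\<^esub>" "x \<otimes>\<^bsub>M3\<^esub> y" "y \<otimes>\<^bsub>M3\<^esub> x"] by (simp add: rs)
  qed
  ultimately obtain \<psi> where "\<psi> \<in> hom laurent_semidirect M3"
    and \<psi>: "\<psi> (axis 1 1, 0) = proj_M3 (free_gen 1)" "\<psi> (axis 2 1, 0) = proj_M3 (free_gen 2)"
      "\<psi> (0, 1) = proj_M3 (free_gen 3)"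
    using M.laurent_semidirect_hom_exists[of "proj_M3 ` R3" "proj_M3 (free_gen 1)"
        "proj_M3 (free_gen 2)" "proj_M3 (free_gen 3)"] R_gen gen by auto
  define g :: "nat \<Rightarrow> (int_laurent^2) \<times> int" where
    "g i = (if i = 1 then (axis 1 1, 0) else if i = 2 then (axis 2 1, 0) else (0, 1))" for i
  obtain \<phi> where "\<phi> \<in> hom F3 laurent_semidirect" and \<phi>: "\<And>i. i \<in> {1, 2, 3} \<Longrightarrow> \<phi> (free_gen i) = g i"
    using free_group_hom_exists[OF group_laurent_semidirect, of g "{1, 2, 3}"] by (auto simp: F3_def)
  interpret \<phi>: group_hom F3 laurent_semidirect \<phi>
    using \<open>\<phi> \<in> _\<close> by (simp add: group_hom_def group_hom_axioms_def)
  have F_gen: "generate F3 (free_gen ` {1, 2, 3}) = carrier F3"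
    unfolding F3_def by (rule free_group_generate)
  have "group_hom F3 M3 (\<psi> \<circ> \<phi>)"
    using hom_compose[OF \<phi>.homh \<open>\<psi> \<in> _\<close>] by (simp add: group_hom_def group_hom_axioms_def)
  then have "proj_M3 w = (\<psi> \<circ> \<phi>) w" if "w \<in> carrier F3" for w
  proof (rule p.hom_eq_on_generate)
    show "free_gen ` {1, 2, 3} \<subseteq> carrier F3"
      using gen by blast
    show "proj_M3 x = (\<psi> \<circ> \<phi>) x" if "x \<in> free_gen ` {1, 2, 3}" for x
      using that by (auto simp: \<phi> g_def \<psi> simp del: One_nat_def)
    show "w \<in> generate F3 (free_gen ` {1, 2, 3})"
      using that by (simp only: F_gen)
  qed
  then have \<psi>\<phi>: "\<psi> (\<phi> w) = proj_M3 w" if "w \<in> carrier F3" for w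
    using that by simp
  have \<phi>_surj: "\<phi> ` carrier F3 = UNIV"
  proof (rule subgroup_laurent_semidirect_eq_UNIV)
    show "subgroup (\<phi> ` carrier F3) laurent_semidirect"
      by (rule \<phi>.img_is_subgroup)
    have "g i \<in> \<phi> ` carrier F3" if "i \<in> {1, 2, 3}" for i
      using \<phi>[OF that] gen[OF that] by (metis image_eqI)
    from this[of 1] this[of 2] this[of 3]
    show "(axis 1 1, 0) \<in> \<phi> ` carrier F3" "(axis 2 1, 0) \<in> \<phi> ` carrier F3"
      "(0, 1) \<in> \<phi> ` carrier F3"
      by (simp_all add: g_def)
  qed
  \<comment> \<open>The vectors form a normal subgroup; its preimage is normal and contains both
    generators of R.\<close>
  have R_vimage: "R3 \<subseteq> {w \<in> carrier F3. \<phi> w \<in> range (\<lambda>v. (v, 0))}"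
    unfolding R3_def
  proof (rule normal_closure_minimal)
    have "normal_closure laurent_semidirect {(axis 1 1, 0), (axis 2 1, 0)} \<lhd> laurent_semidirect"
      by (rule N.normal_closure_normal) simp
    then have "range (\<lambda>v. (v, 0)) \<lhd> laurent_semidirect"
      by (simp only: normal_closure_axes)
    then show "{w \<in> carrier F3. \<phi> w \<in> range (\<lambda>v. (v, 0))} \<lhd> F3"
      by (rule \<phi>.normal_vimage)
    show "{free_gen 1, free_gen 2} \<subseteq> {w \<in> carrier F3. \<phi> w \<in> range (\<lambda>v. (v, 0))}"
      by (simp add: gen \<phi> g_def image_iff del: One_nat_def)
  qed
  \<comment> \<open>Vectors commute, so commutators of elements of R are sent to the
    identity.\<close>
  have "derived_set F3 R3 \<subseteq> kernel F3 laurent_semidirect \<phi>"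
  proof
    fix x assume "x \<in> derived_set F3 R3"
    then obtain r s where rs: "r \<in> R3" "s \<in> R3"
      and x: "x = r \<otimes>\<^bsub>F3\<^esub> s \<otimes>\<^bsub>F3\<^esub> inv\<^bsub>F3\<^esub> r \<otimes>\<^bsub>F3\<^esub> inv\<^bsub>F3\<^esub> s"
      by auto
    note [simp] = R.mem_carrier[OF rs(1)] R.mem_carrier[OF rs(2)]
    have "\<phi> r \<in> range (\<lambda>v. (v, 0))" "\<phi> s \<in> range (\<lambda>v. (v, 0))"
      using R_vimage rs by auto
    then obtain v w where "\<phi> r = (v, 0)" "\<phi> s = (w, 0)"
      by auto
    then show "x \<in> kernel F3 laurent_semidirect \<phi>"
      by (simp add: kernel_def one_laurent_semidirect x)
  qed
  then have "derived F3 R3 \<subseteq> kernel F3 laurent_semidirect \<phi>"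
    unfolding derived_def by (rule F.generate_subgroup_incl[OF _ \<phi>.subgroup_kernel])
  then obtain f where "f \<in> hom M3 laurent_semidirect"
    and f: "\<And>w. w \<in> carrier F3 \<Longrightarrow> f (proj_M3 w) = \<phi> w"
    using \<phi>.FactGroup_universal_kernel[OF D.normal_axioms] unfolding M3_def proj_M3_def by metis
  have "bij_betw f (carrier M3) (carrier laurent_semidirect)"
  proof (rule bij_betw_imageI)
    have "\<psi> (f x) = x" if x: "x \<in> carrier M3" for x
      using x f \<psi>\<phi> unfolding p_surj[symmetric] by auto
    then show "inj_on f (carrier M3)"
      by (rule inj_on_inverseI)
    show "f ` carrier M3 = carrier laurent_semidirect"
      unfolding p_surj[symmetric] image_image using f \<phi>_surj by simp
  qed
  then have "f \<in> iso M3 laurent_semidirect"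
    using \<open>f \<in> hom _ _\<close> by (simp add: iso_def)
  moreover have "f (proj_M3 (free_gen 1)) = (axis 1 1, 0)" "f (proj_M3 (free_gen 2)) = (axis 2 1, 0)"
    by (simp_all add: f gen \<phi> g_def del: One_nat_def)
  ultimately show ?thesis by blast
qed

lemma proj_M3_in_carrier: "w \<in> carrier F3 \<Longrightarrow> proj_M3 w \<in> carrier M3"
  by (simp add: M3_def proj_M3_def carrier_FactGroup)

theorem proposition1p7:
  shows "(\<forall>A :: int_laurent^2^2. invertible A \<longrightarrow> tame A) \<longleftrightarrow>
    (\<forall>Y'. Y' \<subseteq> carrier M3 \<and> card Y' = 2 \<and>
        normal_closure M3 Y' = normal_closure M3 {proj_M3 (free_gen 1), proj_M3 (free_gen 2)} \<longrightarrow>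
      ac_equivalent_sets M3 Y' {proj_M3 (free_gen 1), proj_M3 (free_gen 2)})"
proof -
  let ?x = "proj_M3 (free_gen 1)" and ?y = "proj_M3 (free_gen 2)"
  obtain f where f: "f \<in> iso M3 laurent_semidirect" "f ?x = (axis 1 1, 0)" "f ?y = (axis 2 1, 0)"
    using M3_iso_laurent_semidirect by blast
  have xy: "?x \<in> carrier M3" "?y \<in> carrier M3"
    by (auto simp: F3_def intro!: proj_M3_in_carrier free_gen_in_carrier)
  let ?g = "inv_into (carrier M3) f"
  have g: "?g \<in> iso laurent_semidirect M3"
    by (rule group.iso_set_sym[OF group_M3 f(1)])
  have "inj_on f (carrier M3)"
    using f(1) by (simp add: iso_def bij_betw_def)
  then have g_axis: "?g (axis 1 1, 0) = ?x" "?g (axis 2 1, 0) = ?y"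
    using xy by (simp_all flip: f(2,3))
  \<comment> \<open>The transport lemma is used once for \<open>f\<close> and once for its
    inverse.\<close>
  have "ac_trivial_pair M3 ?x ?y \<longleftrightarrow> ac_trivial_pair laurent_semidirect (axis 1 1, 0) (axis 2 1, 0)"
  proof
    assume "ac_trivial_pair M3 ?x ?y"
    then show "ac_trivial_pair laurent_semidirect (axis 1 1, 0) (axis 2 1, 0)"
      by (intro ac_trivial_pair_iso[OF group_laurent_semidirect group_M3 g]) (simp_all only: g_axis, simp_all)
  next
    assume "ac_trivial_pair laurent_semidirect (axis 1 1, 0) (axis 2 1, 0)"
    then show "ac_trivial_pair M3 ?x ?y"
      by (intro ac_trivial_pair_iso[OF group_M3 group_laurent_semidirect f(1) xy]) (simp only: f(2,3))
  qed
  then have "(\<forall>A :: int_laurent^2^2. invertible A \<longrightarrow> tame A) \<longleftrightarrow> ac_trivial_pair M3 ?x ?y"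
    using tame_imp_ac_trivial ac_trivial_imp_tame by blast
  then show ?thesis
    unfolding ac_trivial_pair_def .
qed

end
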